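(* Let $p$ be a prime and let $R$ be a unique factorization domain containing a field of characteristic $p$ such that $R$ is not a field. Then for each $n\ge 2$ there exists an $R$-algebra automorphism of the polynomial ring $R[x_1,\ldots,x_n]$ of order $p$ which is not exponential over $R$.
   Context: A $\mathbf{G}_a$-action on a ring $B$ is a ring homomorphism $E:B\to B[T]$ ($T$ a variable) such that: (A1) $E$ followed by $T\mapsto 0$ is the identity of $B$; (A2) if $E(b)=\sum_i b_iT^i$, then $\sum_i E(b_i)|_{T=T_1}\,T_2^i=\sum_i b_i(T_1+T_2)^i$ in $B[T_1,T_2]$, for all $b\in B$. Its invariant ring is $B^E=\{b\in B\mid E(b)=b\}$. For $a\in B^E$, $E_a:B\to B$ is $E$ followed by $T\mapsto a$; it is an automorphism of $B$. For a subring $R\subset B$, $E$ is over $R$ if $R\subset B^E$. An automorphism $\sigma$ of $B$ is exponential over $R$ if $\sigma=E_a$ for some $\mathbf{G}_a$-action $E$ on $B$ over $R$ and some $a\in B^E$. *)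

theory Defs
  imports
    "HOL-Computational_Algebra.Computational_Algebra"
    "HOL-Library.Cardinality"
    "HOL-Library.Poly_Mapping"
begin

definition is_ring_hom :: "('a::comm_ring_1 \<Rightarrow> 'b::comm_ring_1) \<Rightarrow> bool" where
  "is_ring_hom f \<longleftrightarrow>
     f 1 = 1 \<and> (\<forall>x y. f (x + y) = f x + f y) \<and> (\<forall>x y. f (x * y) = f x * f y)"

definition is_ring_automorphism :: "('a::comm_ring_1 \<Rightarrow> 'a) \<Rightarrow> bool" where
  "is_ring_automorphism \<sigma> \<longleftrightarrow> is_ring_hom \<sigma> \<and> bij \<sigma>"

definition is_subfield :: "'a::comm_ring_1 set \<Rightarrow> bool" where
  "is_subfield K \<longleftrightarrow>
     0 \<in> K \<and> 1 \<in> K \<and> (0::'a) \<noteq> 1 \<and>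
     (\<forall>x\<in>K. \<forall>y\<in>K. x - y \<in> K \<and> x * y \<in> K) \<and>
     (\<forall>x\<in>K. x \<noteq> 0 \<longrightarrow> (\<exists>y\<in>K. x * y = 1))"

text \<open>
  A subfield contains the unit element of the ring, so its characteristic is the additive
  order of that element, i.e. the ambient \<open>CHAR('a)\<close>.
\<close>
definition is_subfield_of_char :: "nat \<Rightarrow> 'a::comm_ring_1 set \<Rightarrow> bool" where
  "is_subfield_of_char p K \<longleftrightarrow> is_subfield K \<and> CHAR('a) = p"

text \<open>
  The ring \<open>B[T\<^sub>1, T\<^sub>2]\<close> is the type of polynomials in \<open>T\<^sub>2\<close> over \<open>B[T\<^sub>1]\<close>, so that
  \<open>T\<^sub>1\<close> is \<open>[:[:0, 1:]:]\<close>, \<open>T\<^sub>2\<close> is \<open>[:0, 1:]\<close>, an element \<open>f\<close> of \<open>B[T\<^sub>1]\<close> is \<open>[:f:]\<close>,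
  and an element \<open>b\<close> of \<open>B\<close> is \<open>[:[:b:]:]\<close>.
\<close>
definition Ga_action :: "('b::comm_ring_1 \<Rightarrow> 'b poly) \<Rightarrow> bool" where
  "Ga_action E \<longleftrightarrow>
     is_ring_hom E \<and>
     (\<forall>b. poly (E b) 0 = b) \<and>
     (\<forall>b. (\<Sum>i\<le>degree (E b). [:E (coeff (E b) i):] * [:0, 1:] ^ i) =
          (\<Sum>i\<le>degree (E b). [:[:coeff (E b) i:]:] * ([:[:0, 1:]:] + [:0, 1:]) ^ i))"

definition Ga_invariants :: "('b::comm_ring_1 \<Rightarrow> 'b poly) \<Rightarrow> 'b set" where
  "Ga_invariants E = {b. E b = [:b:]}"

definition Ga_eval :: "('b::comm_ring_1 \<Rightarrow> 'b poly) \<Rightarrow> 'b \<Rightarrow> 'b \<Rightarrow> 'b" where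
  "Ga_eval E a b = poly (E b) a"

definition exponential_over :: "'b::comm_ring_1 set \<Rightarrow> ('b \<Rightarrow> 'b) \<Rightarrow> bool" where
  "exponential_over R \<sigma> \<longleftrightarrow>
     (\<exists>E a. Ga_action E \<and> R \<subseteq> Ga_invariants E \<and> a \<in> Ga_invariants E \<and> \<sigma> = Ga_eval E a)"

text \<open>
  The polynomial ring over \<open>'a\<close> in variables indexed by \<open>'n\<close>: finitely supported maps
  from exponent vectors to coefficients.
\<close>
type_synonym ('n, 'a) mpolys = "('n \<Rightarrow>\<^sub>0 nat) \<Rightarrow>\<^sub>0 'a"

definition const_poly :: "'a::comm_ring_1 \<Rightarrow> ('n, 'a) mpolys" where
  "const_poly c = Poly_Mapping.single 0 c"

definition is_algebra_automorphism ::
    "(('n, 'a::comm_ring_1) mpolys \<Rightarrow> ('n, 'a) mpolys) \<Rightarrow> bool" where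
  "is_algebra_automorphism \<sigma> \<longleftrightarrow>
     is_ring_automorphism \<sigma> \<and> (\<forall>c. \<sigma> (const_poly c) = const_poly c)"

definition has_order :: "nat \<Rightarrow> ('b \<Rightarrow> 'b) \<Rightarrow> bool" where
  "has_order m \<sigma> \<longleftrightarrow> 0 < m \<and> \<sigma> ^^ m = id \<and> (\<forall>k. 0 < k \<and> k < m \<longrightarrow> \<sigma> ^^ k \<noteq> id)"

end

theory Submission
  imports Defs
begin

text \<open>
  Let \<open>r \<in> R\<close> be neither zero nor a unit, \<open>z = r x\<^sub>i + x\<^sub>j\<^sup>p - x\<^sub>j\<close> and \<open>f = 1 + r z\<close>. The automorphism
  of \<open>R[1/r][x]\<close> that fixes \<open>z\<close> and sends \<open>x\<^sub>j\<close> to \<open>x\<^sub>j + f\<close> restricts to the polynomial ring over \<open>R\<close>,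
  since \<open>f\<^sup>p - f\<close> is divisible by \<open>r\<close>, and all \<open>\<sigma> b - b\<close> are multiples of \<open>f\<close>.
  Suppose that \<open>\<sigma> = E\<^sub>a\<close>. The ideal generated by \<open>f\<close> is stable under \<open>E\<close>, which forces \<open>f\<close>, hence
  \<open>z\<close>, to be invariant. Applying \<open>E\<close> to \<open>z\<close> shows that \<open>h = E(x\<^sub>j) - x\<^sub>j\<close> satisfies \<open>h\<^sup>p = h\<close> modulo \<open>r\<close>;
  as \<open>h\<close> vanishes at \<open>T = 0\<close>, it vanishes modulo \<open>r\<close>. But \<open>h(a) = f\<close> is \<open>1\<close> modulo \<open>r\<close>.
\<close>

section \<open>Ring homomorphisms\<close>

lemma is_ring_homD:
  assumes "is_ring_hom f"
  shows "f 1 = 1" "f (x + y) = f x + f y" "f (x * y) = f x * f y"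
    "f 0 = 0" "f (- x) = - f x" "f (x - y) = f x - f y" "f (x ^ n) = f x ^ n"
    "f (of_nat n) = of_nat n" "f (sum g A) = (\<Sum>i\<in>A. f (g i))"
proof -
  show one: "f 1 = 1" and add: "f (x + y) = f x + f y" and mult: "f (x * y) = f x * f y" for x y
    using assms by (auto simp: is_ring_hom_def)
  show zero: "f 0 = 0" using add[of 0 0] by simp
  show minus: "f (- x) = - f x" for x using add[of x "- x"] zero by (simp add: eq_neg_iff_add_eq_0 add.commute)
  show "f (x - y) = f x - f y" using add[of x "- y"] minus by simp
  show "f (x ^ n) = f x ^ n" by (induction n) (simp_all add: one mult)
  show "f (of_nat n) = of_nat n" by (induction n) (simp_all add: zero one add)
  show "f (sum g A) = (\<Sum>i\<in>A. f (g i))"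
    by (induction A rule: infinite_finite_induct) (simp_all add: zero add)
qed

section \<open>\<open>G\<^sub>a\<close>-actions\<close>

lemma pCons_0_1_power_eq_monom: "[:0, 1:] ^ n = monom (1 :: 'b::comm_semiring_1) n"
  by (simp add: monom_altdef)

text \<open>Compare coefficients of \<open>T\<^sub>2 ^ i\<close> in the second action axiom;
  \<open>[:[:0, 1:], 1:]\<close> is \<open>T\<^sub>1 + T\<^sub>2\<close>.\<close>

lemma Ga_action_coeff:
  fixes E :: "'b::comm_ring_1 \<Rightarrow> 'b poly"
  assumes "Ga_action E"
  shows "E (coeff (E b) i) =
    (\<Sum>j\<le>degree (E b). [:coeff (E b) j:] * coeff ([:[:0, 1:], 1:] ^ j) i)"
proof -
  let ?d = "degree (E b)"
  have "(\<Sum>i\<le>?d. [:E (coeff (E b) i):] * [:0, 1:] ^ i) =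
        (\<Sum>i\<le>?d. [:[:coeff (E b) i:]:] * [:[:0, 1:], 1:] ^ i)"
    using assms by (simp add: Ga_action_def)
  then have "coeff (\<Sum>i\<le>?d. [:E (coeff (E b) i):] * [:0, 1:] ^ i) i =
        coeff (\<Sum>i\<le>?d. [:[:coeff (E b) i:]:] * [:[:0, 1:], 1:] ^ i) i" by simp
  moreover have "coeff (\<Sum>j\<le>?d. [:E (coeff (E b) j):] * [:0, 1:] ^ j) i = E (coeff (E b) i)"
  proof -
    have "coeff (\<Sum>j\<le>?d. [:E (coeff (E b) j):] * [:0, 1:] ^ j) i =
      (\<Sum>j\<le>?d. if i = j then E (coeff (E b) j) else 0)"
      by (simp add: coeff_sum pCons_0_1_power_eq_monom if_distrib[where f="\<lambda>x. _ * x"] eq_commute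
          cong: if_cong)
    \<comment> \<open>For \<open>i\<close> beyond the degree no summand survives, and
      \<open>E 0 = 0\<close> gives the equality.\<close>
    also have "\<dots> = E (coeff (E b) i)"
      using is_ring_homD(4)[of E] assms by (auto simp: Ga_action_def not_le coeff_eq_0)
    finally show ?thesis .
  qed
  ultimately show ?thesis by (simp add: coeff_sum)
qed

text \<open>With \<open>d = degree (E b)\<close>, among the powers
  \<open>(T\<^sub>1 + T\<^sub>2) ^ j\<close>, \<open>j \<le> d\<close>, only \<open>j = d\<close>
  contributes to \<open>T\<^sub>2 ^ d\<close>, with coefficient 1.\<close>

lemma lead_coeff_Ga_invariant:
  fixes E :: "'b::comm_ring_1 \<Rightarrow> 'b poly"
  assumes "Ga_action E"
  shows "E (lead_coeff (E b)) = [:lead_coeff (E b):]"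
proof -
  let ?d = "degree (E b)"
  have "E (lead_coeff (E b)) =
    (\<Sum>j\<le>?d. [:coeff (E b) j:] * coeff ([:[:0, 1:], 1:] ^ j) ?d)"
    by (rule Ga_action_coeff[OF assms])
  also have "\<dots> = (\<Sum>j\<le>?d. if ?d = j then [:coeff (E b) j:] else 0)"
  proof (rule sum.cong)
    fix j assume "j \<in> {..?d}"
    then show "[:coeff (E b) j:] * coeff ([:[:0, 1:], 1:] ^ j) ?d =
      (if ?d = j then [:coeff (E b) j:] else 0)"
      by (cases "j = ?d") (auto simp: coeff_linear_power degree_linear_power coeff_eq_0)
  qed simp
  finally show ?thesis by simp
qed

text \<open>Setting \<open>T\<^sub>2 = a\<close> in the axiom expands the left side in powers of
  \<open>T + a\<close>; setting \<open>T\<^sub>1 = a\<close> in \<open>Ga_action_coeff\<close>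
  expands the right side. They agree because \<open>T\<^sub>1 + T\<^sub>2\<close> is
  symmetric.\<close>

lemma Ga_action_Ga_eval:
  fixes E :: "'b::comm_ring_1 \<Rightarrow> 'b poly"
  assumes E: "Ga_action E" and a: "a \<in> Ga_invariants E"
  shows "coeff (E (Ga_eval E a b)) i = Ga_eval E a (coeff (E b) i)"
proof -
  let ?d = "degree (E b)"
  have hom: "is_ring_hom E" using E by (simp add: Ga_action_def)
  have Ea: "E a = [:a:]" using a by (simp add: Ga_invariants_def)
  have lin: "poly (coeff ([:[:0, 1:], 1:] ^ j) i) a = coeff ([:a, 1:] ^ j) i" for j
  proof (cases "i \<le> j")
    case True
    then show ?thesis by (simp add: coeff_linear_poly_power of_nat_poly)
  next
    case False
    then show ?thesis by (simp add: coeff_eq_0 degree_linear_power)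
  qed
  have subst: "(\<Sum>i\<le>?d. E (coeff (E b) i) * [:a:] ^ i) =
    (\<Sum>i\<le>?d. [:coeff (E b) i:] * [:a, 1:] ^ i)"
  proof -
    have "(\<Sum>i\<le>?d. [:E (coeff (E b) i):] * [:0, 1:] ^ i) =
        (\<Sum>i\<le>?d. [:[:coeff (E b) i:]:] * [:[:0, 1:], 1:] ^ i)"
      using E by (simp add: Ga_action_def)
    then have "poly (\<Sum>i\<le>?d. [:E (coeff (E b) i):] * [:0, 1:] ^ i) [:a:] =
        poly (\<Sum>i\<le>?d. [:[:coeff (E b) i:]:] * [:[:0, 1:], 1:] ^ i) [:a:]" by simp
    then show ?thesis by (simp add: poly_sum)
  qed
  have "E (Ga_eval E a b) = (\<Sum>i\<le>?d. E (coeff (E b) i) * [:a:] ^ i)"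
    by (simp add: Ga_eval_def poly_altdef is_ring_homD[OF hom] Ea)
  also have "coeff \<dots> i = (\<Sum>j\<le>?d. coeff (E b) j * coeff ([:a, 1:] ^ j) i)"
    unfolding subst by (simp add: coeff_sum)
  also have "\<dots> = poly (E (coeff (E b) i)) a"
    unfolding Ga_action_coeff[OF E] by (simp add: poly_sum lin)
  finally show ?thesis by (simp add: Ga_eval_def)
qed

text \<open>Without zero divisors degrees in \<open>T\<close> add up, so the factors of a nonzero
  constant are constant.\<close>

lemma Ga_invariants_factorially_closed:
  fixes E :: "'b::comm_ring_1 \<Rightarrow> 'b poly"
  assumes nzd: "\<And>x y :: 'b. x * y = 0 \<Longrightarrow> x = 0 \<or> y = 0"
    and E: "Ga_action E" and inv: "x * y \<in> Ga_invariants E" and "x * y \<noteq> 0"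
  shows "x \<in> Ga_invariants E"
proof -
  have hom: "is_ring_hom E" and E0: "poly (E b) 0 = b" for b
    using E by (auto simp: Ga_action_def)
  have "E x \<noteq> 0" "E y \<noteq> 0" using assms(4) E0[of x] E0[of y] by auto
  then have "coeff (E x * E y) (degree (E x) + degree (E y)) \<noteq> 0"
    using nzd by (fastforce simp: coeff_mult_degree_sum)
  moreover have "E x * E y = [:x * y:]"
    using inv by (simp add: is_ring_homD(3)[OF hom] Ga_invariants_def)
  ultimately have "degree (E x) = 0"
    by (metis add_is_0 coeff_eq_0 degree_pCons_0 not_gr0)
  then obtain c where "E x = [:c:]" by (rule degree_eq_zeroE)
  with E0[of x] show ?thesis by (simp add: Ga_invariants_def)
qed

text \<open>
  The ideal generated by all \<open>\<sigma> b - b\<close> is stable under \<open>E\<close>; when it is principal, its generator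
  divides the leading coefficient of its own image under \<open>E\<close>, which is invariant.
\<close>
lemma fixed_ideal_generator_invariant:
  fixes E :: "'b::comm_ring_1 \<Rightarrow> 'b poly"
  assumes nzd: "\<And>x y :: 'b. x * y = 0 \<Longrightarrow> x = 0 \<or> y = 0"
    and E: "Ga_action E" and a: "a \<in> Ga_invariants E"
    and dvd: "\<And>b. f dvd Ga_eval E a b - b"
    and gen: "Ga_eval E a y - y = f"
  shows "f \<in> Ga_invariants E"
proof (cases "f = 0")
  case True
  then show ?thesis
    using E is_ring_homD(4)[of E] by (simp add: Ga_invariants_def Ga_action_def)
next
  case False
  have hom: "is_ring_hom E" and E0: "poly (E b) 0 = b" for b
    using E by (auto simp: Ga_action_def)
  \<comment> \<open>As \<open>f\<close> is \<open>E\<^sub>a y - y\<close>, each coefficient of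
    \<open>E f\<close> is \<open>E\<^sub>a c - c\<close> for a coefficient \<open>c\<close> of
    \<open>E y\<close>.\<close>
  have "f dvd lead_coeff (E f)"
    by (simp flip: gen add: is_ring_homD(6)[OF hom] Ga_action_Ga_eval[OF E a])
       (simp add: gen dvd)
  then obtain q where "lead_coeff (E f) = f * q" by (elim dvdE)
  moreover have "lead_coeff (E f) \<noteq> 0"
    using False E0[of f] by auto
  ultimately show ?thesis
    using Ga_invariants_factorially_closed[OF nzd E, of f q] lead_coeff_Ga_invariant[OF E, of f]
    by (simp add: Ga_invariants_def)
qed

section \<open>Congruences modulo a constant\<close>

lemma dvd_power_add_diff:
  fixes x y r :: "'b::comm_ring_1"
  shows "r dvd (r * x + y) ^ n - y ^ n"
proof -
  have "r * x + y - y dvd (r * x + y) ^ n - y ^ n"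
    by (subst power_diff_sumr2) simp
  then have "r * x dvd (r * x + y) ^ n - y ^ n" by (simp only: add_diff_cancel_right')
  then show ?thesis by (rule dvd_mult_left)
qed

text \<open>
  Modulo \<open>r\<close> the equation reads \<open>h = h ^ p\<close>, so the order of vanishing of \<open>h\<close> at \<open>0\<close> is
  at least \<open>p\<close> times itself.
\<close>
lemma const_dvd_if_eq_power_mod:
  fixes h g :: "'b::comm_ring_1 poly"
  assumes eq: "h = h ^ p + [:r:] * g" and "p \<ge> 2" and "poly h 0 = 0"
  shows "[:r:] dvd h"
proof -
  let ?T = "[:0, 1:] :: 'b poly"
  have "\<exists>u v. h = [:r:] * u + ?T ^ Suc k * v" for k
  proof (induction k)
    case 0
    have "?T dvd h" using assms(3) poly_eq_0_iff_dvd[of h 0] by simp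
    then show ?case by (metis add_0 dvdE mult_zero_right power_one_right One_nat_def)
  next
    case (Suc k)
    then obtain u v where uv: "h = [:r:] * u + ?T ^ Suc k * v" by blast
    from dvd_power_add_diff[of "[:r:]" u "?T ^ Suc k * v" p]
    obtain w where "h ^ p - (?T ^ Suc k * v) ^ p = [:r:] * w"
      unfolding uv[symmetric] by (elim dvdE)
    then have "h ^ p = [:r:] * w + (?T ^ Suc k * v) ^ p" by (simp only: diff_eq_eq)
    with eq have "h = [:r:] * (w + g) + (?T ^ Suc k * v) ^ p"
      by (simp only: distrib_left add.assoc add.commute[of "[:r:] * g"] add.left_commute)
    moreover have "?T ^ Suc (Suc k) dvd (?T ^ Suc k * v) ^ p"
    proof -
      \<comment> \<open>The order of vanishing modulo \<open>r\<close> grows strictly at each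
        round.\<close>
      have "Suc (Suc k) \<le> Suc k * p" using \<open>p \<ge> 2\<close>
        by (metis add_Suc_right mult.commute mult_2_right mult_le_mono1 le_trans le_add1 add_Suc)
      then have "?T ^ Suc (Suc k) dvd ?T ^ (Suc k * p)" by (rule le_imp_power_dvd)
      then show ?thesis by (simp only: power_mult_distrib power_mult dvd_mult2)
    qed
    ultimately show ?case by (metis dvdE)
  qed
  then obtain u v where uv: "h = [:r:] * u + ?T ^ Suc (degree h) * v" by blast
  \<comment> \<open>The \<open>T\<close>-power term only affects coefficients above
    \<open>degree h\<close>; truncating \<open>u\<close> there makes the equation exact.\<close>
  have "coeff h i = coeff ([:r:] * poly_cutoff (Suc (degree h)) u) i" for i
  proof (cases "i \<le> degree h")
    case True
    then show ?thesis
      by (subst uv) (simp add: pCons_0_1_power_eq_monom coeff_monom_mult coeff_poly_cutoff del: power_Suc)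
  qed (simp add: coeff_eq_0 coeff_poly_cutoff)
  then have "h = [:r:] * poly_cutoff (Suc (degree h)) u" by (rule poly_eqI)
  then show ?thesis by (rule dvdI)
qed

section \<open>Polynomials in several variables\<close>

lemma poly_mapping_add_induct [case_names single add]:
  fixes P :: "'k \<Rightarrow>\<^sub>0 'a::comm_monoid_add"
  assumes "\<And>k c. Q (Poly_Mapping.single k c)"
    and "\<And>P P'. Q P \<Longrightarrow> Q P' \<Longrightarrow> Q (P + P')"
  shows "Q P"
proof (induction P rule: update_induct)
  case const
  show ?case using assms(1)[of undefined 0] by simp
next
  case (update f k v)
  have "Poly_Mapping.update k v f = f + Poly_Mapping.single k v"
    using update(1)
    by (intro poly_mapping_eqI)
       (auto simp: lookup_update lookup_add lookup_single when_def in_keys_iff)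
  then show ?case using assms update by simp
qed

text \<open>The universal map out of a monoid algebra. It serves both for substituting polynomials
  and for relabelling exponents.\<close>

definition monomial_extension ::
    "('a::comm_ring_1 \<Rightarrow> 'c::comm_ring_1) \<Rightarrow> ('k \<Rightarrow> 'c) \<Rightarrow> ('k \<Rightarrow>\<^sub>0 'a) \<Rightarrow> 'c" where
  "monomial_extension c \<mu> P = (\<Sum>m\<in>Poly_Mapping.keys P. c (Poly_Mapping.lookup P m) * \<mu> m)"

lemma monomial_extension_superset:
  assumes "is_ring_hom c" "finite A" "Poly_Mapping.keys P \<subseteq> A"
  shows "monomial_extension c \<mu> P = (\<Sum>m\<in>A. c (Poly_Mapping.lookup P m) * \<mu> m)"
  unfolding monomial_extension_def using assms(2,3)
  by (intro sum.mono_neutral_left) (auto simp: in_keys_iff is_ring_homD(4)[OF assms(1)])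

lemma monomial_extension_single:
  assumes "is_ring_hom c"
  shows "monomial_extension c \<mu> (Poly_Mapping.single m a) = c a * \<mu> m"
  by (subst monomial_extension_superset[OF assms, of "{m}"]) auto

lemma monomial_extension_add:
  assumes "is_ring_hom c"
  shows "monomial_extension c \<mu> (P + Q) = monomial_extension c \<mu> P + monomial_extension c \<mu> Q"
  using Poly_Mapping.keys_add[of P Q]
  by (simp add: monomial_extension_superset[OF assms, of "Poly_Mapping.keys P \<union> Poly_Mapping.keys Q"] lookup_add
      is_ring_homD(2)[OF assms] distrib_right sum.distrib)

lemma is_ring_hom_monomial_extension:
  fixes c :: "'a::comm_ring_1 \<Rightarrow> 'c::comm_ring_1" and \<mu> :: "'k::comm_monoid_add \<Rightarrow> 'c"
  assumes c: "is_ring_hom c" and "\<mu> 0 = 1" and "\<And>m n. \<mu> (m + n) = \<mu> m * \<mu> n"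
  shows "is_ring_hom (monomial_extension c \<mu>)"
proof -
  let ?e = "monomial_extension c \<mu>"
  have "?e (P * Q) = ?e P * ?e Q" for P Q
  proof (induction P rule: poly_mapping_add_induct)
    case (single k a)
    show ?case
    proof (induction Q rule: poly_mapping_add_induct)
      case (single l b)
      then show ?case
        by (simp add: mult_single monomial_extension_single[OF c] is_ring_homD(3)[OF c] assms(3) ac_simps)
    qed (simp add: distrib_left monomial_extension_add[OF c])
  qed (simp add: distrib_right monomial_extension_add[OF c])
  moreover have "?e 1 = 1"
    by (simp flip: single_one add: monomial_extension_single[OF c] is_ring_homD(1)[OF c] assms(2))
  ultimately show ?thesis by (simp add: is_ring_hom_def monomial_extension_add[OF c])
qed

lemma is_ring_hom_const_poly: "is_ring_hom (const_poly :: 'a::comm_ring_1 \<Rightarrow> ('n, 'a) mpolys)"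
  by (simp add: is_ring_hom_def const_poly_def single_add mult_single)

definition mvar :: "'n \<Rightarrow> ('n, 'a::comm_ring_1) mpolys" where
  "mvar i = Poly_Mapping.single (Poly_Mapping.single i 1) 1"

lemma single_eq_prod_mvar:
  "Poly_Mapping.single m (c :: 'a::comm_ring_1) =
    const_poly c * (\<Prod>i\<in>UNIV. mvar (i :: 'n::finite) ^ Poly_Mapping.lookup m i)"
proof -
  have pow: "mvar i ^ k = Poly_Mapping.single (Poly_Mapping.single i k) (1 :: 'a)" for i :: 'n and k
    by (induction k) (simp_all add: mvar_def mult_single flip: single_add)
  have "(\<Prod>i\<in>A. Poly_Mapping.single (Poly_Mapping.single i (Poly_Mapping.lookup m i)) (1 :: 'a)) =
    Poly_Mapping.single (\<Sum>i\<in>A. Poly_Mapping.single i (Poly_Mapping.lookup m i)) 1" for A :: "'n set"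
    by (induction A rule: infinite_finite_induct) (simp_all add: mult_single)
  moreover have "(\<Sum>i\<in>UNIV. Poly_Mapping.single i (Poly_Mapping.lookup m i)) = m"
    by (intro poly_mapping_eqI) (simp add: lookup_sum lookup_single when_def)
  ultimately show ?thesis by (simp add: pow const_poly_def mult_single)
qed

text \<open>Lets identities and divisibilities for \<open>\<sigma>\<close> be checked on
  generators.\<close>

lemma mpolys_induct [case_names const mvar add mult]:
  fixes P :: "('n::finite, 'a::comm_ring_1) mpolys"
  assumes "\<And>c. Q (const_poly c)" and "\<And>i. Q (mvar i)"
    and "\<And>P P'. Q P \<Longrightarrow> Q P' \<Longrightarrow> Q (P + P')" and mult: "\<And>P P'. Q P \<Longrightarrow> Q P' \<Longrightarrow> Q (P * P')"
  shows "Q P"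
proof (induction P rule: poly_mapping_add_induct)
  case (single m c)
  have one: "Q 1" using assms(1)[of 1] by (simp add: const_poly_def)
  have "Q (mvar i ^ k)" for i k by (induction k) (simp_all add: one assms)
  then have "Q (\<Prod>i\<in>A. mvar i ^ Poly_Mapping.lookup m i)" for A
    by (induction A rule: infinite_finite_induct) (simp_all add: one mult)
  then show ?case unfolding single_eq_prod_mvar by (intro mult assms(1))
qed (rule assms(3))

lemma exists_substitution:
  fixes s :: "'n::finite \<Rightarrow> ('n, 'a::comm_ring_1) mpolys"
  obtains \<sigma> where "is_ring_hom \<sigma>" "\<And>c. \<sigma> (const_poly c) = const_poly c" "\<And>i. \<sigma> (mvar i) = s i"
proof
  let ?\<mu> = "\<lambda>m. \<Prod>i\<in>UNIV. s i ^ Poly_Mapping.lookup m i"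
  let ?\<sigma> = "monomial_extension const_poly ?\<mu>"
  show "is_ring_hom ?\<sigma>"
    by (rule is_ring_hom_monomial_extension)
       (simp_all add: is_ring_hom_const_poly lookup_add power_add prod.distrib)
  show "?\<sigma> (const_poly c) = const_poly c" for c
    by (simp add: const_poly_def monomial_extension_single[OF is_ring_hom_const_poly])
  show "?\<sigma> (mvar i) = s i" for i
  proof -
    have "s j ^ Poly_Mapping.lookup (Poly_Mapping.single i 1) j = (if j = i then s i else 1)" for j
      by (simp add: lookup_single when_def)
    then show ?thesis
      by (simp add: mvar_def monomial_extension_single is_ring_hom_const_poly
          is_ring_homD(1)[OF is_ring_hom_const_poly])
  qed
qed

text \<open>
  The library makes polynomial mappings an integral domain only for linearly ordered exponents,
  so the exponent vectors are embedded into \<open>nat \<Rightarrow>\<^sub>0 nat\<close>.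
\<close>
lemma mpolys_no_zero_divisors:
  fixes P Q :: "('n::finite, 'a::idom) mpolys"
  assumes "P * Q = 0"
  shows "P = 0 \<or> Q = 0"
proof -
  obtain e :: "'n \<Rightarrow> nat" where e: "inj e"
    using finite_imp_inj_to_nat_seg[of "UNIV :: 'n set"] by auto
  define \<kappa> :: "('n \<Rightarrow>\<^sub>0 nat) \<Rightarrow> (nat \<Rightarrow>\<^sub>0 nat)" where
    "\<kappa> m = (\<Sum>i\<in>UNIV. Poly_Mapping.single (e i) (Poly_Mapping.lookup m i))" for m
  have lookup_\<kappa>: "Poly_Mapping.lookup (\<kappa> m) (e i) = Poly_Mapping.lookup m i" for m i
    using e by (simp add: \<kappa>_def lookup_sum lookup_single when_def inj_eq)
  have inj: "inj \<kappa>"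
    by (rule injI, rule poly_mapping_eqI) (metis lookup_\<kappa>)
  define \<Phi> :: "('n, 'a) mpolys \<Rightarrow> ((nat \<Rightarrow>\<^sub>0 nat) \<Rightarrow>\<^sub>0 'a)" where
    "\<Phi> = monomial_extension (Poly_Mapping.single 0) (\<lambda>m. Poly_Mapping.single (\<kappa> m) 1)"
  have "is_ring_hom (Poly_Mapping.single 0 :: 'a \<Rightarrow> ((nat \<Rightarrow>\<^sub>0 nat) \<Rightarrow>\<^sub>0 'a))"
    by (simp add: is_ring_hom_def single_add mult_single)
  then have hom: "is_ring_hom \<Phi>" unfolding \<Phi>_def
    by (rule is_ring_hom_monomial_extension)
       (simp_all add: \<kappa>_def lookup_add single_add sum.distrib mult_single)
  \<comment> \<open>Injectivity of \<open>\<kappa>\<close> keeps distinct monomials apart, so every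
    coefficient of \<open>P\<close> can be recovered.\<close>
  have "Poly_Mapping.lookup (\<Phi> P) (\<kappa> m) = Poly_Mapping.lookup P m" for P m
  proof -
    have "Poly_Mapping.lookup (\<Phi> P) (\<kappa> m) = (\<Sum>k\<in>Poly_Mapping.keys P. if k = m then Poly_Mapping.lookup P k else 0)"
      using inj
      by (auto simp: \<Phi>_def monomial_extension_def lookup_sum mult_single lookup_single when_def
          inj_eq intro!: sum.cong)
    then show ?thesis by (simp add: in_keys_iff)
  qed
  then have ker: "\<Phi> P = 0 \<Longrightarrow> P = 0" for P
    by (metis lookup_zero poly_mapping_eqI)
  have "\<Phi> P * \<Phi> Q = 0"
    using assms is_ring_homD(3,4)[OF hom] by metis
  then show ?thesis using ker by auto
qed

section \<open>Units and characteristic of the polynomial ring\<close>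

lemma const_poly_dvd_one_iff:
  "const_poly r dvd (1 :: ('n, 'a::comm_ring_1) mpolys) \<longleftrightarrow> r dvd 1"
proof
  assume "const_poly r dvd (1 :: ('n, 'a) mpolys)"
  then obtain b where "1 = const_poly r * (b :: ('n, 'a) mpolys)" by (elim dvdE)
  then have "Poly_Mapping.lookup (const_poly r * b) 0 = 1" by (metis lookup_one_zero)
  moreover have "const_poly r * b = Poly_Mapping.map ((*) r) b"
    by (simp add: mult_map_scale_conv_mult const_poly_def)
  then have "Poly_Mapping.lookup (const_poly r * b) 0 = r * Poly_Mapping.lookup b 0"
    by (simp add: Poly_Mapping.map.rep_eq when_def)
  ultimately have "1 = r * Poly_Mapping.lookup b 0" by simp
  then show "r dvd 1" by (rule dvdI)
next
  assume "r dvd 1"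
  then obtain s where "1 = r * s" by (elim dvdE)
  then have "(1 :: ('n, 'a) mpolys) = const_poly r * const_poly s"
    using is_ring_homD(1,3)[OF is_ring_hom_const_poly] by metis
  then show "const_poly r dvd (1 :: ('n, 'a) mpolys)" by (rule dvdI)
qed

lemma CHAR_mpolys: "CHAR(('n, 'a::comm_ring_1) mpolys) = CHAR('a)"
proof (rule CHAR_eqI)
  show "of_nat CHAR('a) = (0 :: ('n, 'a) mpolys)"
    by (simp flip: single_of_nat)
  show "CHAR('a) dvd n" if "of_nat n = (0 :: ('n, 'a) mpolys)" for n
  proof -
    have "Poly_Mapping.lookup (of_nat n :: ('n, 'a) mpolys) 0 = of_nat n"
      by (simp add: lookup_of_nat)
    then have "of_nat n = (0 :: 'a)" unfolding that by simp
    then show ?thesis by (simp only: of_nat_eq_0_iff_char_dvd)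
  qed
qed

section \<open>Construction of the automorphism and failure of exponentiality\<close>

theorem mainTheorem2:
  fixes p :: nat
  assumes "prime p"
    and "\<exists>K :: 'a::{idom, factorial_semiring} set. is_subfield_of_char p K"
    and "\<not> (\<forall>x :: 'a. x \<noteq> 0 \<longrightarrow> x dvd 1)"
    and "CARD('n::finite) \<ge> 2"
  shows "\<exists>\<sigma> :: ('n, 'a) mpolys \<Rightarrow> ('n, 'a) mpolys.
           is_algebra_automorphism \<sigma> \<and> has_order p \<sigma> \<and>
           \<not> exponential_over (range const_poly) \<sigma>"
proof -
  have char: "CHAR('a) = p" using assms(2) by (auto simp: is_subfield_of_char_def)
  have charB: "CHAR(('n, 'a) mpolys) = p" using char by (simp add: CHAR_mpolys)
  have p2: "p \<ge> 2" using \<open>prime p\<close> by (rule prime_ge_2_nat)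
  obtain r0 :: 'a where "r0 \<noteq> 0" and nonunit: "\<not> r0 dvd 1" using assms(3) by blast
  obtain i j :: 'n where "i \<noteq> j"
  proof -
    have "\<not> card (UNIV :: 'n set) \<le> Suc 0" using assms(4) by simp
    then show thesis using that by (auto simp: card_le_Suc0_iff_eq)
  qed
  define r where "r = (const_poly r0 :: ('n, 'a) mpolys)"
  define z where "z = r * mvar i + mvar j ^ p - mvar j"
  define f where "f = 1 + r * z"
  \<comment> \<open>This is \<open>(f - f ^ p) / r\<close>, because
    \<open>f ^ p = 1 + r ^ p * z ^ p\<close>; it is the shift of \<open>mvar i\<close> that keeps
    \<open>z\<close> fixed.\<close>
  define u where "u = z - r ^ (p - 1) * z ^ p"
  have add_pow: "(x + y) ^ p = x ^ p + y ^ p" for x y :: "('n, 'a) mpolys"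
    using freshmans_dream[where ?'a = "('n, 'a) mpolys"] charB \<open>prime p\<close> by simp
  have "r * r ^ (p - 1) = r ^ p"
    using p2 by (metis One_nat_def Suc_diff_le diff_Suc_Suc diff_zero le_trans one_le_numeral power_Suc)
  then have ru: "r * u = f - f ^ p"
    by (simp add: u_def f_def add_pow power_mult_distrib right_diff_distrib flip: mult.assoc)
  obtain \<sigma> :: "('n, 'a) mpolys \<Rightarrow> ('n, 'a) mpolys" where hom: "is_ring_hom \<sigma>"
    and const: "\<And>c. \<sigma> (const_poly c) = const_poly c"
    and var: "\<And>k. \<sigma> (mvar k) = (if k = i then mvar i + u else if k = j then mvar j + f else mvar k)"
    by (rule exists_substitution[of "\<lambda>k. if k = i then mvar i + u else if k = j then mvar j + f else mvar k"])
       blast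
  note \<sigma> = is_ring_homD[OF hom]
  have \<sigma>r: "\<sigma> r = r" by (simp add: r_def const)
  have \<sigma>z: "\<sigma> z = z"
    using \<open>i \<noteq> j\<close> ru by (simp add: z_def \<sigma> \<sigma>r var add_pow algebra_simps)
  have \<sigma>f: "\<sigma> f = f" and \<sigma>u: "\<sigma> u = u"
    by (simp_all add: f_def u_def \<sigma> \<sigma>r \<sigma>z)
  \<comment> \<open>The shifts \<open>u\<close> and \<open>f\<close> are themselves fixed, so
    iterating only multiplies them by \<open>n\<close>.\<close>
  have iter: "(\<sigma> ^^ n) (mvar i) = mvar i + of_nat n * u"
    "(\<sigma> ^^ n) (mvar j) = mvar j + of_nat n * f" for n
    using \<open>i \<noteq> j\<close> by (induction n) (simp_all add: \<sigma> \<sigma>f \<sigma>u var algebra_simps)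
  have iter': "(\<sigma> ^^ n) (mvar k) = mvar k" if "k \<noteq> i" "k \<noteq> j" for n k
    using that by (induction n) (simp_all add: var)
  have "of_nat p = (0 :: ('n, 'a) mpolys)"
    using of_nat_CHAR[where ?'a = "('n, 'a) mpolys"] charB by simp
  then have fix_vars: "(\<sigma> ^^ p) (mvar k) = mvar k" for k
    using iter[of p] iter'[of k p] by (cases "k = i"; cases "k = j") simp_all
  have hom_iter: "is_ring_hom (\<sigma> ^^ n)" for n
    by (induction n) (use \<sigma> in \<open>simp_all add: is_ring_hom_def\<close>)
  have const_iter: "(\<sigma> ^^ n) (const_poly c) = const_poly c" for n c
    by (induction n) (simp_all add: const)
  have "(\<sigma> ^^ p) P = P" for P
    by (induction P rule: mpolys_induct)
       (simp_all add: fix_vars const_iter is_ring_homD(2,3)[OF hom_iter])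
  then have order: "\<sigma> ^^ p = id" by auto
  have "bij \<sigma>"
  proof (rule o_bij)
    show "\<sigma> ^^ (p - 1) \<circ> \<sigma> = id" "\<sigma> \<circ> \<sigma> ^^ (p - 1) = id"
      using order p2 funpow_add[of 1 "p - 1" \<sigma>] funpow_add[of "p - 1" 1 \<sigma>] by simp_all
  qed
  then have automorphism: "is_algebra_automorphism \<sigma>"
    using hom const by (simp add: is_algebra_automorphism_def is_ring_automorphism_def)
  \<comment> \<open>If \<open>f\<close> vanished, \<open>r\<close> would be a unit with inverse
    \<open>- z\<close>.\<close>
  have "of_nat k * f \<noteq> 0" if k: "0 < k" "k < p" for k
  proof
    assume "of_nat k * f = 0"
    moreover have "of_nat k \<noteq> (0 :: ('n, 'a) mpolys)"
      using k charB by (auto simp: of_nat_eq_0_iff_char_dvd dest: dvd_imp_le)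
    ultimately have "f = 0" using mpolys_no_zero_divisors by blast
    then have "r * (- z) = 1" unfolding f_def by (metis add_eq_0_iff2 mult_minus_right)
    then have "r dvd 1" by (metis dvd_triv_left)
    then show False using nonunit by (simp add: r_def const_poly_dvd_one_iff)
  qed
  then have "\<sigma> ^^ k \<noteq> id" if "0 < k" "k < p" for k
    using iter(2)[of k] that by fastforce
  then have ord: "has_order p \<sigma>"
    using order p2 by (simp add: has_order_def)
  have f_u: "f dvd u"
  proof -
    \<comment> \<open>Multiply \<open>u\<close> by \<open>1 = f - r * z\<close>;
      \<open>r * u\<close> is a multiple of \<open>f\<close>.\<close>
    have "u = f * u - z * (r * u)" by (simp add: f_def algebra_simps)
    also have "f dvd \<dots>" unfolding ru using p2 by (intro dvd_diff dvd_mult dvd_triv_left) auto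
    finally show ?thesis .
  qed
  have dvd: "f dvd \<sigma> P - P" for P
  proof (induction P rule: mpolys_induct)
    case (mvar k)
    then show ?case using f_u by (simp add: var)
  next
    case (add P Q)
    have "\<sigma> (P + Q) - (P + Q) = (\<sigma> P - P) + (\<sigma> Q - Q)" by (simp add: \<sigma>)
    then show ?case using add by (simp only: dvd_add)
  next
    case (mult P Q)
    \<comment> \<open>A twisted Leibniz rule.\<close>
    have "\<sigma> (P * Q) - P * Q = (\<sigma> P - P) * \<sigma> Q + P * (\<sigma> Q - Q)" by (simp add: \<sigma> algebra_simps)
    then show ?case using mult by (simp only: dvd_add dvd_mult dvd_mult2)
  qed (simp add: const)
  have "\<not> exponential_over (range const_poly) \<sigma>"
  proof
    assume "exponential_over (range const_poly) \<sigma>"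
    then obtain E a where E: "Ga_action E" and "range const_poly \<subseteq> Ga_invariants E"
      and a: "a \<in> Ga_invariants E" and \<sigma>E: "\<sigma> = Ga_eval E a"
      by (auto simp: exponential_over_def)
    then have Er: "E r = [:r:]" by (auto simp: r_def Ga_invariants_def)
    have homE: "is_ring_hom E" and E0: "poly (E b) 0 = b" for b
      using E by (auto simp: Ga_action_def)
    note E' = is_ring_homD[OF homE]
    have "f \<in> Ga_invariants E"
    proof (rule fixed_ideal_generator_invariant[OF _ E a])
      show "f dvd Ga_eval E a P - P" for P using dvd \<sigma>E by simp
      show "Ga_eval E a (mvar j) - mvar j = f" using \<open>i \<noteq> j\<close> by (simp flip: \<sigma>E add: var)
    qed (rule mpolys_no_zero_divisors)
    moreover have "[:f:] = 1 + [:r:] * [:z:]" by (simp add: f_def one_pCons)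
    ultimately have "1 + [:r:] * E z = 1 + [:r:] * [:z:]"
      by (simp only: Ga_invariants_def f_def E' Er mem_Collect_eq)
    then have "[:r:] * (E z - [:z:]) = 0" by (simp only: add_left_cancel right_diff_distrib diff_self)
    \<comment> \<open>The nonzero \<open>r\<close> is cancelled in each coefficient
      separately.\<close>
    then have "coeff ([:r:] * (E z - [:z:])) n = 0" for n by simp
    then have "r * coeff (E z - [:z:]) n = 0" for n by (simp del: coeff_diff)
    moreover have "r \<noteq> 0" using \<open>r0 \<noteq> 0\<close> unfolding r_def const_poly_def
      by (metis lookup_single_eq lookup_zero)
    ultimately have "coeff (E z - [:z:]) n = 0" for n
      using mpolys_no_zero_divisors by blast
    then have "E z - [:z:] = 0" by (intro poly_eqI) (simp only: coeff_0)
    then have Ez: "E z = [:z:]" by (simp only: right_minus_eq)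
    define h where "h = E (mvar j) - [:mvar j:]"
    have charP: "CHAR(('n, 'a) mpolys poly) = p" using charB by simp
    have "E (mvar j) = h + [:mvar j:]" by (simp add: h_def)
    then have "E z = [:r:] * E (mvar i) + (h ^ p + [:mvar j:] ^ p) - (h + [:mvar j:])"
      using freshmans_dream[where ?'a = "('n, 'a) mpolys poly"] charP \<open>prime p\<close>
      by (simp add: z_def E' Er)
    moreover have "[:z:] = [:r:] * [:mvar i:] + [:mvar j:] ^ p - [:mvar j:]"
      by (simp add: z_def poly_const_pow)
    \<comment> \<open>Equate the two expressions for \<open>E z\<close>; the terms in
      \<open>mvar j\<close> cancel.\<close>
    ultimately have "h = h ^ p + [:r:] * (E (mvar i) - [:mvar i:])"
      unfolding Ez by (simp add: algebra_simps)
    moreover have "poly h 0 = 0" by (simp add: h_def E0)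
    ultimately have "[:r:] dvd h" using p2 by (intro const_dvd_if_eq_power_mod)
    \<comment> \<open>Evaluating at \<open>T = a\<close> turns \<open>h\<close> into
      \<open>f = 1 + r * z\<close>, so \<open>r\<close> would divide 1.\<close>
    then have "r dvd poly h a" by auto
    moreover have "poly h a = f"
      using var[of j] \<open>i \<noteq> j\<close> by (simp add: h_def \<sigma>E Ga_eval_def)
    ultimately have "r dvd 1" by (simp add: f_def dvd_add_left_iff)
    then show False using nonunit by (simp add: r_def const_poly_dvd_one_iff)
  qed
  with automorphism ord show ?thesis by blast
qed

end
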